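(* Let $\overline{\mathbf{x}}\in\{0,1\}^m$ be a current solution candidate, i.e. the indicator vector of a set $\overline{S}\subset[m]$ with $|\overline{S}|=C$, and let $\Delta$ be a positive even integer. Let $d_j=\nabla f^{\mathrm{GEV}}(\overline{\mathbf{x}})_j$ for $j\in[m]$. Consider the subproblem $$\max_{\mathbf{x}\in\{0,1\}^m}\ \nabla f^{\mathrm{GEV}}(\overline{\mathbf{x}})^{T}\mathbf{x}\quad\text{subject to}\quad\sum_{j\in[m]}x_j=C,\qquad\sum_{j\in[m]}|x_j-\overline{x}_j|\le\Delta .$$ Then the following algorithm returns an optimal solution to this subproblem (in the form of a set $S^*$, identified with its indicator vector), with complexity $\mathcal{O}(m\Delta/2)$. Algorithm. Step 1 (take the smallest coefficients in $\overline{S}$ and the largest coefficients in $[m]\setminus\overline{S}$): choose $\sigma^1_1,\dots,\sigma^1_{\Delta/2}\in\overline{S}$ (distinct) and $\sigma^2_1,\dots,\sigma^2_{\Delta/2}\in[m]\setminus\overline{S}$ (distinct) such that $$d_{\sigma^1_1}\le d_{\sigma^1_2}\le\dots\le d_{\sigma^1_{\Delta/2}}\le\min_{j\in\overline{S}\setminus\{\sigma^1_1,\dots,\sigma^1_{\Delta/2}\}}d_j,$$ $$d_{\sigma^2_1}\ge d_{\sigma^2_2}\ge\dots\ge d_{\sigma^2_{\Delta/2}}\ge\max_{j\in([m]\setminus\overline{S})\setminus\{\sigma^2_1,\dots,\sigma^2_{\Delta/2}\}}d_j .$$ Step 2: for $t=1,\dots,\Delta/2$ compute $\gamma(t)=\sum_{h=1}^{t}\left(d_{\sigma^2_h}-d_{\sigma^1_h}\right)$,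 and select $t^*\in\arg\max_{t=1,\dots,\Delta/2}\gamma(t)$. Step 3: return $S^*=\left(\overline{S}\cup\{\sigma^2_1,\dots,\sigma^2_{t^*}\}\right)\setminus\{\sigma^1_1,\dots,\sigma^1_{t^*}\}$.
   Context: Let $[m]=\{1,\dots,m\}$ be the set of candidate facility locations, let $C$ be an integer with $1\le C\le m$ (the number of facilities to open), and let $I$ be the set of customer zones. Zone $i\in I$ has $q_i$ customers and deterministic utilities $v_{ij}$ for $j\in[m]$; $\mathbf{Y}^i$ is the vector of size $m$ with entries $Y^i_j=e^{v_{ij}}$. The choice behaviour of customers in zone $i$ is given by a generalized extreme value (GEV) model specified by a choice probability generating function (CPGF) $G^i$. A CPGF $G(\mathbf{Y})$ of a GEV model has the following properties, where $\partial G_{j_1\dots j_k}$ denotes the mixed partial derivative of $G$ with respect to $Y_{j_1},\dots,Y_{j_k}$: (i) $G(\mathbf{Y})\ge 0$ for all $\mathbf{Y}\in\mathbb{R}^m_+$; (ii) $G$ is homogeneous of degree one, i.e. $G(\lambda\mathbf{Y})=\lambda G(\mathbf{Y})$; (iii) $G(\mathbf{Y})\to\infty$ if $Y_j\to\infty$; (iv) for $j_1,\dots,j_k\in[m]$ distinct from each other, $\partial G_{j_1\dots j_k}(\mathbf{Y})>0$ if $k$ is odd, and $\partial G_{j_1\dots j_k}(\mathbf{Y})\le 0$ if $k$ is even; (v) $G(\mathbf{Y})=\sum_{j\in[m]}Y_j\,\partial G_j(\mathbf{Y})$; (vi) $\sum_{k\in[m]}Y_k\,\partial G_{jk}(\mathbf{Y})=0$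 for all $j\in[m]$. With the total utility of the competitors normalized to 1, the expected captured demand is the differentiable function $$f^{\mathrm{GEV}}(\mathbf{x})=\sum_{i\in I}q_i-\sum_{i\in I}\frac{q_i}{1+G^i(\mathbf{x}\circ\mathbf{Y}^i)},$$ where $\mathbf{x}\circ\mathbf{Y}^i$ is the vector with entries $x_jY^i_j$; a binary vector $\mathbf{x}$ represents the set of locations $j$ with $x_j=1$. $\nabla f^{\mathrm{GEV}}(\overline{\mathbf{x}})$ is the gradient of $f^{\mathrm{GEV}}$ with respect to $\mathbf{x}$ at $\overline{\mathbf{x}}$.
   Formalization: As t starts at 1 the output is never S̄, so the claim fails when x̄ is the unique optimum; proved: the output is optimal unless x̄ is the unique optimum, and always optimal among feasible points other than x̄. Δ/2 ≤ C and Δ/2 ≤ m−C are assumed so that Step 1 can be carried out. *)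

theory Defs
  imports "HOL-Analysis.Analysis" "HOL-Library.Landau_Symbols" "HOL-Library.Monad_Syntax"
begin

text \<open>A vector of size \<open>m\<close> is a function on \<open>nat\<close> that vanishes outside \<open>{1..m}\<close>; a dimension
  indexed by a number rather than a type lets the complexity bound be uniform in \<open>m\<close>.\<close>

definition vectors :: "nat \<Rightarrow> (nat \<Rightarrow> real) set" where
  "vectors m = {y. \<forall>j. j \<notin> {1..m} \<longrightarrow> y j = 0}"

definition nonneg_orthant :: "nat \<Rightarrow> (nat \<Rightarrow> real) set" where
  "nonneg_orthant m = {y \<in> vectors m. \<forall>j\<in>{1..m}. 0 \<le> y j}"

definition pos_orthant :: "nat \<Rightarrow> (nat \<Rightarrow> real) set" where
  "pos_orthant m = {y \<in> vectors m. \<forall>j\<in>{1..m}. 0 < y j}"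

definition partial :: "nat \<Rightarrow> ((nat \<Rightarrow> real) \<Rightarrow> real) \<Rightarrow> (nat \<Rightarrow> real) \<Rightarrow> real" where
  "partial j F y = deriv (\<lambda>t. F (y(j := t))) (y j)"

definition has_partial :: "nat \<Rightarrow> ((nat \<Rightarrow> real) \<Rightarrow> real) \<Rightarrow> (nat \<Rightarrow> real) \<Rightarrow> bool" where
  "has_partial j F y \<longleftrightarrow> (\<lambda>t. F (y(j := t))) field_differentiable (at (y j))"

definition mixed_partial :: "nat list \<Rightarrow> ((nat \<Rightarrow> real) \<Rightarrow> real) \<Rightarrow> (nat \<Rightarrow> real) \<Rightarrow> real" where
  "mixed_partial js F = foldr partial js F"

text \<open>Since \<open>deriv\<close> is total, the existence of the first, the mixed and the second partial
  derivatives is required explicitly. Derivatives are taken on the open orthant: for nested models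
  they need not exist, or need not be positive, where some coordinate is zero.\<close>

definition cpgf :: "nat \<Rightarrow> ((nat \<Rightarrow> real) \<Rightarrow> real) \<Rightarrow> bool" where
  "cpgf m G \<longleftrightarrow>
     (\<forall>y\<in>nonneg_orthant m. 0 \<le> G y) \<and>
     (\<forall>y\<in>nonneg_orthant m. \<forall>c>0. G (\<lambda>j. c * y j) = c * G y) \<and>
     (\<forall>y\<in>nonneg_orthant m. \<forall>j\<in>{1..m}. filterlim (\<lambda>t. G (y(j := t))) at_top at_top) \<and>
     (\<forall>y\<in>pos_orthant m. \<forall>j js. distinct (j # js) \<and> set (j # js) \<subseteq> {1..m} \<longrightarrow>
        has_partial j (mixed_partial js G) y) \<and>
     (\<forall>y\<in>pos_orthant m. \<forall>j\<in>{1..m}. \<forall>k\<in>{1..m}. has_partial k (partial j G) y) \<and>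
     (\<forall>y\<in>pos_orthant m. \<forall>js. js \<noteq> [] \<and> distinct js \<and> set js \<subseteq> {1..m} \<longrightarrow>
        (odd (length js) \<longrightarrow> 0 < mixed_partial js G y) \<and>
        (even (length js) \<longrightarrow> mixed_partial js G y \<le> 0)) \<and>
     (\<forall>y\<in>pos_orthant m. G y = (\<Sum>j\<in>{1..m}. y j * partial j G y)) \<and>
     (\<forall>y\<in>pos_orthant m. \<forall>j\<in>{1..m}. (\<Sum>k\<in>{1..m}. y k * mixed_partial [k, j] G y) = 0)"

definition f_GEV :: "'i set \<Rightarrow> ('i \<Rightarrow> real) \<Rightarrow> ('i \<Rightarrow> nat \<Rightarrow> real) \<Rightarrow>
    ('i \<Rightarrow> (nat \<Rightarrow> real) \<Rightarrow> real) \<Rightarrow> (nat \<Rightarrow> real) \<Rightarrow> real" where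
  "f_GEV I q v G x =
     (\<Sum>i\<in>I. q i) - (\<Sum>i\<in>I. q i / (1 + G i (\<lambda>j. x j * exp (v i j))))"

text \<open>The partial derivatives are taken within the nonnegative half-line, because \<open>f_GEV\<close> is only
  meaningful for nonnegative arguments and binary vectors have zero entries.\<close>

definition has_gradient :: "nat \<Rightarrow> ((nat \<Rightarrow> real) \<Rightarrow> real) \<Rightarrow> (nat \<Rightarrow> real) \<Rightarrow> (nat \<Rightarrow> real) \<Rightarrow> bool" where
  "has_gradient m f x d \<longleftrightarrow>
     (\<forall>j\<in>{1..m}. ((\<lambda>t. f (x(j := t))) has_real_derivative d j) (at (x j) within {0..}))"

definition feasible :: "nat \<Rightarrow> nat \<Rightarrow> (nat \<Rightarrow> real) \<Rightarrow> nat \<Rightarrow> (nat \<Rightarrow> real) set" where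
  "feasible m C xbar \<Delta> =
     {x \<in> vectors m. (\<forall>j\<in>{1..m}. x j \<in> {0, 1}) \<and> (\<Sum>j\<in>{1..m}. x j) = real C \<and>
        (\<Sum>j\<in>{1..m}. \<bar>x j - xbar j\<bar>) \<le> real \<Delta>}"

definition objective :: "nat \<Rightarrow> (nat \<Rightarrow> real) \<Rightarrow> (nat \<Rightarrow> real) \<Rightarrow> real" where
  "objective m d x = (\<Sum>j\<in>{1..m}. d j * x j)"

text \<open>The last two conjuncts say that the algorithm can be run: it chooses \<open>\<Delta>/2\<close> distinct elements
  from each of \<open>S\<close> and its complement.\<close>

definition valid_input :: "nat \<Rightarrow> nat \<Rightarrow> nat set \<Rightarrow> nat \<Rightarrow> bool" where
  "valid_input m C S \<Delta> \<longleftrightarrow>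
     1 \<le> C \<and> C \<le> m \<and> S \<subseteq> {1..m} \<and> card S = C \<and> 0 < \<Delta> \<and> even \<Delta> \<and>
     \<Delta> div 2 \<le> C \<and> \<Delta> div 2 \<le> m - C"

definition step1 :: "nat \<Rightarrow> (nat \<Rightarrow> real) \<Rightarrow> nat set \<Rightarrow> nat \<Rightarrow> (nat \<Rightarrow> nat) \<Rightarrow> (nat \<Rightarrow> nat) \<Rightarrow> bool" where
  "step1 m d S K \<sigma>1 \<sigma>2 \<longleftrightarrow>
     inj_on \<sigma>1 {1..K} \<and> \<sigma>1 ` {1..K} \<subseteq> S \<and>
     (\<forall>h\<in>{1..<K}. d (\<sigma>1 h) \<le> d (\<sigma>1 (Suc h))) \<and>
     (\<forall>j\<in>S - \<sigma>1 ` {1..K}. d (\<sigma>1 K) \<le> d j) \<and>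
     inj_on \<sigma>2 {1..K} \<and> \<sigma>2 ` {1..K} \<subseteq> {1..m} - S \<and>
     (\<forall>h\<in>{1..<K}. d (\<sigma>2 h) \<ge> d (\<sigma>2 (Suc h))) \<and>
     (\<forall>j\<in>({1..m} - S) - \<sigma>2 ` {1..K}. d (\<sigma>2 K) \<ge> d j)"

definition gamma :: "(nat \<Rightarrow> real) \<Rightarrow> (nat \<Rightarrow> nat) \<Rightarrow> (nat \<Rightarrow> nat) \<Rightarrow> nat \<Rightarrow> real" where
  "gamma d \<sigma>1 \<sigma>2 t = (\<Sum>h = 1..t. d (\<sigma>2 h) - d (\<sigma>1 h))"

text \<open>\<open>algorithm_returns m d S \<Delta> T\<close>: for some way of breaking ties in the choice of
  \<open>\<sigma>1\<close>, \<open>\<sigma>2\<close> and \<open>t\<close>, the algorithm outputs \<open>T\<close>. As \<open>t\<close> starts at 1, the output is never \<open>S\<close> itself, although the indicator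
  vector of \<open>S\<close> is feasible. Hence the output is not optimal if that vector is the unique optimal
  solution: for instance \<open>m = 2\<close>, \<open>\<Delta> = 2\<close>, \<open>S = {1}\<close> and \<open>d 1 > d 2\<close>.\<close>

definition algorithm_returns :: "nat \<Rightarrow> (nat \<Rightarrow> real) \<Rightarrow> nat set \<Rightarrow> nat \<Rightarrow> nat set \<Rightarrow> bool" where
  "algorithm_returns m d S \<Delta> T \<longleftrightarrow>
     (\<exists>\<sigma>1 \<sigma>2 t. step1 m d S (\<Delta> div 2) \<sigma>1 \<sigma>2 \<and>
        is_arg_max (gamma d \<sigma>1 \<sigma>2) (\<lambda>t. t \<in> {1..\<Delta> div 2}) t \<and>
        T = (S \<union> \<sigma>2 ` {1..t}) - \<sigma>1 ` {1..t})"

text \<open>For the complexity claim the algorithm is also given as a program that counts its elementary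
  operations. \<open>d\<close> and the sets are arrays (sets as arrays of flags); \<open>unit_cost\<close> is charged for each
  membership test, comparison (with the reads it needs), update of a running sum, and insertion or
  deletion. The vector \<open>d\<close> is part of the input.\<close>

type_synonym 'a counted = "'a \<times> nat"

definition return :: "'a \<Rightarrow> 'a counted" where
  "return x = (x, 0)"

definition unit_cost :: "'a \<Rightarrow> 'a counted" where
  "unit_cost x = (x, 1)"

definition bind_counted :: "'a counted \<Rightarrow> ('a \<Rightarrow> 'b counted) \<Rightarrow> 'b counted" where
  "bind_counted p f = (fst (f (fst p)), snd p + snd (f (fst p)))"

adhoc_overloading Monad_Syntax.bind \<rightleftharpoons> bind_counted

text \<open>Separate arrays for \<open>S\<close> and its complement; \<open>select\<close> below destroys its argument, while \<open>S\<close>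
  itself is still needed at the end.\<close>

fun split_sets :: "nat set \<Rightarrow> nat list \<Rightarrow> (nat set \<times> nat set) counted" where
  "split_sets S [] = return ({}, {})"
| "split_sets S (j # js) = do {
     (A, B) \<leftarrow> split_sets S js;
     b \<leftarrow> unit_cost (j \<in> S);
     unit_cost (if b then (insert j A, B) else (A, insert j B))
   }"

text \<open>The first element of the list, among those lying in \<open>R\<close>, that no other one beats; \<open>best\<close> is
  the best element met so far.\<close>

fun find_best :: "(nat \<Rightarrow> nat \<Rightarrow> bool) \<Rightarrow> nat set \<Rightarrow> nat list \<Rightarrow> nat option \<Rightarrow> nat option counted" where
  "find_best beats R [] best = return best"
| "find_best beats R (j # js) best = do {
     b \<leftarrow> unit_cost (j \<in> R);
     c \<leftarrow> unit_cost (case best of None \<Rightarrow> True | Some i \<Rightarrow> beats j i);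
     find_best beats R js (if b \<and> c then Some j else best)
   }"

fun select :: "(nat \<Rightarrow> nat \<Rightarrow> bool) \<Rightarrow> nat \<Rightarrow> nat \<Rightarrow> nat set \<Rightarrow> nat list counted" where
  "select beats m 0 R = return []"
| "select beats m (Suc k) R = do {
     best \<leftarrow> find_best beats R [1..<Suc m] None;
     (case best of
        None \<Rightarrow> return []
      | Some j \<Rightarrow> do {
          R' \<leftarrow> unit_cost (R - {j});
          js \<leftarrow> select beats m k R';
          return (j # js)
        })
   }"

text \<open>\<open>t\<close> is the number of pairs processed, \<open>g = \<gamma>(t)\<close>, and \<open>best\<close> is the best pair \<open>(t, \<gamma>(t))\<close> so far.\<close>

fun best_prefix :: "(nat \<Rightarrow> real) \<Rightarrow> nat list \<Rightarrow> nat list \<Rightarrow> nat \<Rightarrow> real \<Rightarrow> (nat \<times> real) option \<Rightarrow> nat counted" where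
  "best_prefix d (a # as) (b # bs) t g best = do {
     g' \<leftarrow> unit_cost (g + (d b - d a));
     c \<leftarrow> unit_cost (case best of None \<Rightarrow> True | Some (_, gb) \<Rightarrow> gb < g');
     best_prefix d as bs (Suc t) g' (if c then Some (Suc t, g') else best)
   }"
| "best_prefix d _ _ t g best = return (case best of None \<Rightarrow> 0 | Some (tb, _) \<Rightarrow> tb)"

fun swap_prefix :: "nat \<Rightarrow> nat list \<Rightarrow> nat list \<Rightarrow> nat set \<Rightarrow> nat set counted" where
  "swap_prefix (Suc t) (a # as) (b # bs) S = do {
     S1 \<leftarrow> unit_cost (insert b S);
     S2 \<leftarrow> unit_cost (S1 - {a});
     swap_prefix t as bs S2
   }"
| "swap_prefix _ _ _ S = return S"

definition algorithm :: "nat \<Rightarrow> (nat \<Rightarrow> real) \<Rightarrow> nat set \<Rightarrow> nat \<Rightarrow> nat set counted" where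
  "algorithm m d S \<Delta> = do {
     (A, B) \<leftarrow> split_sets S [1..<Suc m];
     as \<leftarrow> select (\<lambda>j i. d j < d i) m (\<Delta> div 2) A;
     bs \<leftarrow> select (\<lambda>j i. d j > d i) m (\<Delta> div 2) B;
     t \<leftarrow> best_prefix d as bs 0 0 None;
     swap_prefix t as bs S
   }"

definition result :: "'a counted \<Rightarrow> 'a" where "result = fst"

definition cost :: "'a counted \<Rightarrow> nat" where "cost = snd"

end

theory Submission
  imports Defs
begin

text \<open>
  The objective \<open>d\<^sup>T x\<close>, with \<open>d\<close> the gradient, is linear, so the problem is combinatorial.
  The feasible points are the indicator vectors of the sets \<open>X\<close> with \<open>C\<close> elements
  that arise from \<open>S\<close> by exchanging at most \<open>K = \<Delta> / 2\<close> elements (\<open>feasible_eq_exchanges\<close>): two sets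
  of equal size differ by as many removals as insertions, so an exchange of \<open>k\<close> elements has
  \<open>l\<^sub>1\<close>-distance \<open>2 k\<close>. Such an exchange changes the objective by the sum of \<open>d\<close> over the inserted elements
  minus the sum of \<open>d\<close> over the removed ones. For fixed \<open>k\<close> the two sums are optimized independently:
  insert the \<open>k\<close> largest coefficients outside \<open>S\<close> and remove the \<open>k\<close> smallest ones inside
  (\<open>sum_le_sum_greedy_prefix\<close>). Hence \<open>\<gamma>(k)\<close> is the best gain of an exchange of exactly \<open>k\<close> elements.

  Maximizing over \<open>1 \<le> k \<le> K\<close> gives the best feasible point other than the current one
  (\<open>greedy_exchange_optimal\<close>). The current point is the case \<open>k = 0\<close>, with gain \<open>0\<close>. So the output is
  optimal if \<open>\<gamma>(t\<^sup>*) \<ge> 0\<close>, and otherwise the current point is the unique optimum.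

  The program finds each of its \<open>2 K\<close> exchange candidates by one scan of \<open>[m]\<close>, at a cost linear in \<open>m\<close>; all its other
  work costs \<open>O(m + K)\<close>, which \<open>O(m K)\<close> absorbs because \<open>m\<close> and \<open>K\<close> are at least \<open>1\<close>.
\<close>

section \<open>Greedy selection\<close>

text \<open>Both halves of the first step are the same selection: of the largest coefficients
  for the key \<open>d\<close> on the complement of \<open>S\<close>, and for the key \<open>- d\<close> on \<open>S\<close>.\<close>

definition greedy_selection :: "('a \<Rightarrow> real) \<Rightarrow> 'a set \<Rightarrow> nat \<Rightarrow> (nat \<Rightarrow> 'a) \<Rightarrow> bool" where
  "greedy_selection key U K \<sigma> \<longleftrightarrow>
     inj_on \<sigma> {1..K} \<and> \<sigma> ` {1..K} \<subseteq> U \<and>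
     (\<forall>h\<in>{1..<K}. key (\<sigma> (Suc h)) \<le> key (\<sigma> h)) \<and>
     (\<forall>j\<in>U - \<sigma> ` {1..K}. key j \<le> key (\<sigma> K))"

lemma step1_iff_greedy_selections:
  "step1 m d S K \<sigma>1 \<sigma>2 \<longleftrightarrow>
     greedy_selection (\<lambda>j. - d j) S K \<sigma>1 \<and> greedy_selection d ({1..m} - S) K \<sigma>2"
  unfolding step1_def greedy_selection_def by auto

lemma greedy_selection_antimono:
  assumes "greedy_selection key U K \<sigma>" and "1 \<le> i" and "i \<le> j" and "j \<le> K"
  shows "key (\<sigma> j) \<le> key (\<sigma> i)"
  using \<open>i \<le> j\<close> \<open>j \<le> K\<close>
proof (induction j rule: dec_induct)
  case (step n)
  then have "key (\<sigma> (Suc n)) \<le> key (\<sigma> n)"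
    using assms(1,2) unfolding greedy_selection_def by auto
  then show ?case using step by simp
qed simp

lemma card_Diff_eq_card_Diff:
  assumes "finite A" and "finite B" and "card A = card B"
  shows "card (A - B) = card (B - A)"
  using assms by (metis add_right_imp_eq card_Int_Diff inf_commute add.commute)

text \<open>Exchange argument with the threshold \<open>c = key (\<sigma> k)\<close>: after cancelling the common elements of \<open>B\<close>
  and the prefix, two sets of equal size remain, and keys are at most \<open>c\<close> on one and
  at least \<open>c\<close> on the other.\<close>

lemma sum_le_sum_greedy_prefix:
  assumes greedy: "greedy_selection key U K \<sigma>"
    and "finite B" and "B \<subseteq> U" and "1 \<le> card B" and "card B \<le> K"
  shows "sum key B \<le> (\<Sum>h = 1..card B. key (\<sigma> h))"
proof -
  define k where "k = card B"
  define T where "T = \<sigma> ` {1..k}"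
  have k: "1 \<le> k" "k \<le> K" using assms by (auto simp: k_def)
  have inj: "inj_on \<sigma> {1..k}"
    using greedy k by (auto simp: greedy_selection_def intro: inj_on_subset)
  then have card_T: "card T = k" by (simp add: T_def card_image)
  have "finite T" by (simp add: T_def)
  have upper: "key j \<le> key (\<sigma> k)" if "j \<in> B - T" for j
  proof (cases "j \<in> \<sigma> ` {1..K}")
    case True
    then obtain h where h: "h \<in> {1..K}" "j = \<sigma> h" by auto
    then have "k \<le> h" using that by (force simp: T_def)
    then show ?thesis using greedy_selection_antimono[OF greedy] h k by auto
  next
    case False
    then have "key j \<le> key (\<sigma> K)"
      using greedy that \<open>B \<subseteq> U\<close> by (auto simp: greedy_selection_def)
    also have "\<dots> \<le> key (\<sigma> k)" using greedy_selection_antimono[OF greedy] k by auto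
    finally show ?thesis .
  qed
  have lower: "key (\<sigma> k) \<le> key j" if "j \<in> T - B" for j
    using that greedy_selection_antimono[OF greedy] k by (auto simp: T_def)
  have card_eq: "card (B - T) = card (T - B)"
    using \<open>finite B\<close> \<open>finite T\<close> card_T k_def by (simp add: card_Diff_eq_card_Diff)
  have "sum key B = sum key (B \<inter> T) + sum key (B - T)"
    using \<open>finite B\<close> by (rule sum.Int_Diff)
  also have "sum key (B - T) \<le> of_nat (card (B - T)) * key (\<sigma> k)"
    using upper by (intro sum_bounded_above) auto
  also have "\<dots> = of_nat (card (T - B)) * key (\<sigma> k)" by (simp add: card_eq)
  also have "\<dots> \<le> sum key (T - B)"
    using lower by (intro sum_bounded_below) auto
  also have "sum key (B \<inter> T) + sum key (T - B) = sum key T"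
    using sum.Int_Diff[OF \<open>finite T\<close>, of key B] by (simp add: inf_commute)
  also have "sum key T = (\<Sum>h = 1..k. key (\<sigma> h))"
    using inj by (simp add: T_def sum.reindex)
  finally show ?thesis by (simp add: k_def)
qed

section \<open>Feasible points as exchanges\<close>

lemma objective_indicator:
  assumes "X \<subseteq> {1..m}"
  shows "objective m d (indicator X) = sum d X"
  using assms by (simp add: objective_def sum.inter_restrict[symmetric] indicator_def
      if_distrib[of "\<lambda>t. _ * t"] Int_absorb1 cong: if_cong)

lemma binary_vector_eq_indicator:
  assumes "x \<in> vectors m" and "\<forall>j\<in>{1..m}. x j \<in> {0, 1}"
  shows "x = indicator {j \<in> {1..m}. x j = 1}"
proof
  fix j
  show "x j = indicator {j \<in> {1..m}. x j = 1} j"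
    using assms by (cases "j \<in> {1..m}") (auto simp: vectors_def indicator_def)
qed

lemma sum_indicator_real:
  fixes X :: "nat set"
  assumes "X \<subseteq> {1..m}"
  shows "(\<Sum>j\<in>{1..m}. indicator X j :: real) = real (card X)"
  using objective_indicator[OF assms, where d = "\<lambda>_. 1"] by (simp add: objective_def)

lemma l1_distance_indicators:
  fixes S X :: "nat set"
  assumes "S \<subseteq> {1..m}" and "X \<subseteq> {1..m}" and "card X = card S"
  shows "(\<Sum>j\<in>{1..m}. \<bar>indicator X j - indicator S j :: real\<bar>) = 2 * real (card (S - X))"
proof -
  have fin: "finite S" "finite X" using assms finite_subset by auto
  have "(\<Sum>j\<in>{1..m}. \<bar>indicator X j - indicator S j :: real\<bar>)
      = (\<Sum>j\<in>{1..m}. indicator (X - S) j + indicator (S - X) j)"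
    by (intro sum.cong) (auto simp: indicator_def)
  also have "\<dots> = real (card (X - S)) + real (card (S - X))"
    unfolding sum.distrib using assms(1,2)
    by (intro arg_cong2[where f = "(+)"] sum_indicator_real) auto
  also have "card (X - S) = card (S - X)"
    using fin assms by (simp add: card_Diff_eq_card_Diff)
  finally show ?thesis by simp
qed

lemma feasible_eq_exchanges:
  assumes "S \<subseteq> {1..m}" and "card S = C"
  shows "feasible m C (indicator S) \<Delta>
    = indicator ` {X. X \<subseteq> {1..m} \<and> card X = C \<and> card (S - X) \<le> \<Delta> div 2}" (is "?L = ?R")
proof (intro equalityI subsetI)
  fix x assume x: "x \<in> ?L"
  define X where "X = {j \<in> {1..m}. x j = 1}"
  have X: "X \<subseteq> {1..m}" "x = indicator X"
    using x binary_vector_eq_indicator[of x m] by (auto simp: feasible_def X_def)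
  have "card X = C"
    using x X(1) sum_indicator_real[of X m] unfolding X(2) feasible_def by auto
  moreover have "2 * real (card (S - X)) \<le> real \<Delta>"
    using x l1_distance_indicators[OF assms(1) X(1)] \<open>card X = C\<close> assms(2)
    unfolding X(2) feasible_def by auto
  then have "card (S - X) \<le> \<Delta> div 2" by linarith
  ultimately show "x \<in> ?R" using X by blast
next
  fix x :: "nat \<Rightarrow> real" assume "x \<in> ?R"
  then obtain X where X: "X \<subseteq> {1..m}" "card X = C" "card (S - X) \<le> \<Delta> div 2" "x = indicator X"
    by auto
  have "2 * real (card (S - X)) \<le> real \<Delta>" using X(3) by linarith
  then show "x \<in> ?L"
    using X assms l1_distance_indicators[OF assms(1) X(1)] sum_indicator_real[OF X(1)]
    by (auto simp: feasible_def vectors_def indicator_def)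
qed

lemma sum_exchange:
  fixes d :: "'a \<Rightarrow> real"
  assumes "finite S" and "finite X"
  shows "sum d X = sum d S + sum d (X - S) - sum d (S - X)"
  using sum.Int_Diff[OF assms(1), of d X] sum.Int_Diff[OF assms(2), of d S]
  by (simp add: inf_commute)

section \<open>Optimality of the greedy exchange\<close>

text \<open>\<open>\<gamma>(k)\<close> bounds the gain of every exchange of \<open>k\<close> elements: apply the selection lemma to the
  inserted elements with key \<open>d\<close> and to the removed ones with key \<open>- d\<close>.\<close>

lemma exchange_gain_le_gamma:
  assumes "step1 m d S K \<sigma>1 \<sigma>2" and "S \<subseteq> {1..m}" and "X \<subseteq> {1..m}"
    and "card X = card S" and "X \<noteq> S" and "card (S - X) \<le> K"
  shows "card (S - X) \<in> {1..K}" and "sum d X \<le> sum d S + gamma d \<sigma>1 \<sigma>2 (card (S - X))"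
proof -
  have fin: "finite S" "finite X" using assms finite_subset by auto
  have card_eq: "card (X - S) = card (S - X)"
    using fin assms by (simp add: card_Diff_eq_card_Diff)
  have "S - X \<noteq> {}"
    using fin assms(4,5) by (metis Diff_eq_empty_iff card_subset_eq)
  then have pos: "1 \<le> card (S - X)"
    using fin by (simp add: Suc_le_eq card_gt_0_iff)
  then show "card (S - X) \<in> {1..K}" using assms by simp
  have "sum d (X - S) \<le> (\<Sum>h = 1..card (S - X). d (\<sigma>2 h))"
    using sum_le_sum_greedy_prefix[of d "{1..m} - S" K \<sigma>2 "X - S"] assms pos fin card_eq
    by (auto simp: step1_iff_greedy_selections)
  moreover have "(\<Sum>j\<in>S - X. - d j) \<le> (\<Sum>h = 1..card (S - X). - d (\<sigma>1 h))"
    using sum_le_sum_greedy_prefix[of "\<lambda>j. - d j" S K \<sigma>1 "S - X"] assms pos fin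
    by (auto simp: step1_iff_greedy_selections)
  ultimately show "sum d X \<le> sum d S + gamma d \<sigma>1 \<sigma>2 (card (S - X))"
    by (simp add: sum_exchange[OF fin] gamma_def sum_subtractf sum_negf)
qed

lemma greedy_exchange:
  assumes "step1 m d S K \<sigma>1 \<sigma>2" and "S \<subseteq> {1..m}" and "t \<in> {1..K}"
    and T_def: "T = (S \<union> \<sigma>2 ` {1..t}) - \<sigma>1 ` {1..t}"
  shows "T \<subseteq> {1..m}" and "card T = card S" and "card (S - T) = t" and "T \<noteq> S"
    and "sum d T = sum d S + gamma d \<sigma>1 \<sigma>2 t"
proof -
  have "{1..t} \<subseteq> {1..K}" using assms by auto
  then have im: "\<sigma>1 ` {1..t} \<subseteq> S" "\<sigma>2 ` {1..t} \<subseteq> {1..m} - S"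
    and inj: "inj_on \<sigma>1 {1..t}" "inj_on \<sigma>2 {1..t}"
    using assms(1) unfolding step1_def by (blast intro: inj_on_subset)+
  have fin: "finite S" "finite T" using assms(2) finite_subset by (auto simp: T_def)
  have removed: "S - T = \<sigma>1 ` {1..t}" and inserted: "T - S = \<sigma>2 ` {1..t}"
    using im unfolding T_def by blast+
  show "T \<subseteq> {1..m}" using im assms(2) unfolding T_def by blast
  show card_removed: "card (S - T) = t" using inj removed by (simp add: card_image)
  have "card (T - S) = t" using inj inserted by (simp add: card_image)
  then show "card T = card S"
    using card_removed fin by (metis card_Int_Diff inf_commute)
  show "T \<noteq> S" using card_removed assms(3) by auto
  show "sum d T = sum d S + gamma d \<sigma>1 \<sigma>2 t"
    using inj by (simp add: sum_exchange[OF fin] removed inserted sum.reindex gamma_def sum_subtractf)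
qed

lemma greedy_exchange_optimal:
  assumes valid: "valid_input m C S \<Delta>" and returns: "algorithm_returns m d S \<Delta> T"
  defines "F \<equiv> feasible m C (indicator S) \<Delta>"
  shows "is_arg_max (objective m d) (\<lambda>x. x \<in> F - {indicator S}) (indicator T)"
    and "is_arg_max (objective m d) (\<lambda>x. x \<in> F) (indicator T) \<or>
      {x. is_arg_max (objective m d) (\<lambda>x. x \<in> F) x} = {indicator S}"
proof -
  have S: "S \<subseteq> {1..m}" "card S = C" using valid by (auto simp: valid_input_def)
  have F: "F = indicator ` {X. X \<subseteq> {1..m} \<and> card X = C \<and> card (S - X) \<le> \<Delta> div 2}"
    unfolding F_def using S by (rule feasible_eq_exchanges)
  obtain \<sigma>1 \<sigma>2 t where step1: "step1 m d S (\<Delta> div 2) \<sigma>1 \<sigma>2"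
    and t: "t \<in> {1..\<Delta> div 2}"
    and t_max: "\<And>s. s \<in> {1..\<Delta> div 2} \<Longrightarrow> gamma d \<sigma>1 \<sigma>2 s \<le> gamma d \<sigma>1 \<sigma>2 t"
    and T: "T = (S \<union> \<sigma>2 ` {1..t}) - \<sigma>1 ` {1..t}"
    using returns unfolding algorithm_returns_def is_arg_max_linorder by blast
  note T_props = greedy_exchange[OF step1 S(1) t T]
  have obj_S: "objective m d (indicator S) = sum d S"
    and obj_T: "objective m d (indicator T) = sum d S + gamma d \<sigma>1 \<sigma>2 t"
    using objective_indicator S(1) T_props by auto
  have S_in: "indicator S \<in> F" using S by (auto simp: F)
  have "indicator T \<noteq> (indicator S :: nat \<Rightarrow> real)"
    using T_props(4) by (auto simp: fun_eq_iff indicator_def split: if_splits)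
  then have T_in: "indicator T \<in> F - {indicator S}"
    using T_props S(2) t by (auto simp: F)
  have le: "objective m d x \<le> sum d S + gamma d \<sigma>1 \<sigma>2 t" if "x \<in> F - {indicator S}" for x
  proof -
    from that obtain X where X: "X \<subseteq> {1..m}" "card X = card S" "card (S - X) \<le> \<Delta> div 2"
      "x = indicator X" "X \<noteq> S" using S(2) by (auto simp: F)
    note gain = exchange_gain_le_gamma[OF step1 S(1) X(1,2,5,3)]
    have "objective m d x = sum d X" using X objective_indicator by auto
    also have "\<dots> \<le> sum d S + gamma d \<sigma>1 \<sigma>2 t" using gain t_max by fastforce
    finally show ?thesis .
  qed
  show "is_arg_max (objective m d) (\<lambda>x. x \<in> F - {indicator S}) (indicator T)"
    unfolding is_arg_max_linorder obj_T using T_in le by blast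
  show "is_arg_max (objective m d) (\<lambda>x. x \<in> F) (indicator T) \<or>
      {x. is_arg_max (objective m d) (\<lambda>x. x \<in> F) x} = {indicator S}"
  proof (cases "gamma d \<sigma>1 \<sigma>2 t \<ge> 0")
    case True
    have "objective m d x \<le> objective m d (indicator T)" if "x \<in> F" for x
      using le[of x] that True obj_S obj_T by (cases "x = indicator S") auto
    then show ?thesis using T_in unfolding is_arg_max_linorder by blast
  next
    case False
    have less: "objective m d x < objective m d (indicator S)" if "x \<in> F" "x \<noteq> indicator S" for x
      using le[of x] that False obj_S by simp
    have "is_arg_max (objective m d) (\<lambda>x. x \<in> F) x \<longleftrightarrow> x = indicator S" for x
      unfolding is_arg_max_def using less S_in by (metis less_asym)
    then show ?thesis by blast
  qed
qed

section \<open>The program computes a greedy exchange\<close>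

lemmas counted_simps = return_def unit_cost_def bind_counted_def split_def

lemma result_split_sets: "fst (split_sets S js) = (set js \<inter> S, set js - S)"
  by (induction js) (auto simp: counted_simps)

text \<open>The optional element \<open>best\<close> competes with the elements of \<open>R\<close> still to be scanned. One scan
  suffices because comparison of keys is transitive: an element that does not beat an earlier best
  element cannot beat a later one.\<close>

lemma result_find_best:
  fixes key :: "nat \<Rightarrow> real"
  defines "beats \<equiv> \<lambda>j i. key i < key j"
  shows "case fst (find_best beats R js best) of
      None \<Rightarrow> set_option best \<union> (set js \<inter> R) = {}
    | Some i \<Rightarrow> i \<in> set_option best \<union> (set js \<inter> R) \<and>
        (\<forall>j\<in>set_option best \<union> (set js \<inter> R). key j \<le> key i)"
proof (induction js arbitrary: best)
  case Nil
  then show ?case by (auto simp: counted_simps split: option.splits)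
next
  case (Cons j js)
  define best' where
    "best' = (if j \<in> R \<and> (case best of None \<Rightarrow> True | Some i \<Rightarrow> beats j i) then Some j else best)"
  have "fst (find_best beats R (j # js) best) = fst (find_best beats R js best')"
    by (simp add: counted_simps best'_def)
  then show ?case
    using Cons[of best']
    by (fastforce simp: best'_def beats_def split: option.splits if_splits)
qed

lemma result_select:
  fixes key :: "nat \<Rightarrow> real"
  assumes "R \<subseteq> {1..m}" and "k \<le> card R"
  defines "js \<equiv> fst (select (\<lambda>j i. key i < key j) m k R)"
  shows "length js = k \<and> distinct js \<and> set js \<subseteq> R \<and> sorted_wrt (\<lambda>i j. key j \<le> key i) js \<and>
    (\<forall>i\<in>set js. \<forall>j\<in>R - set js. key j \<le> key i)"
  using assms(1,2) unfolding js_def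
proof (induction k arbitrary: R)
  case 0
  then show ?case by (simp add: counted_simps)
next
  case (Suc k)
  let ?beats = "\<lambda>j i. key i < key j"
  have "R \<noteq> {}" using Suc.prems by auto
  have range: "set [1..<Suc m] \<inter> R = R" using Suc.prems by auto
  obtain i where i: "fst (find_best ?beats R [1..<Suc m] None) = Some i" "i \<in> R"
    "\<forall>j\<in>R. key j \<le> key i"
    using result_find_best[where key = key and R = R and js = "[1..<Suc m]" and best = None] \<open>R \<noteq> {}\<close>
    unfolding range by (auto split: option.splits)
  have "finite R" using Suc.prems finite_subset by blast
  then have "length (fst (select ?beats m k (R - {i}))) = k \<and>
      distinct (fst (select ?beats m k (R - {i}))) \<and>
      set (fst (select ?beats m k (R - {i}))) \<subseteq> R - {i} \<and>
      sorted_wrt (\<lambda>i j. key j \<le> key i) (fst (select ?beats m k (R - {i}))) \<and>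
      (\<forall>a\<in>set (fst (select ?beats m k (R - {i}))).
        \<forall>j\<in>R - {i} - set (fst (select ?beats m k (R - {i}))). key j \<le> key a)"
    using Suc.prems i(2) by (intro Suc.IH) auto
  moreover have "fst (select ?beats m (Suc k) R) = i # fst (select ?beats m k (R - {i}))"
    using i(1) by (simp add: counted_simps)
  ultimately show ?case using i(2,3) by auto
qed

lemma image_nth_pred_eq_take:
  assumes "t \<le> length xs"
  shows "(\<lambda>h. xs ! (h - 1)) ` {1..t} = set (take t xs)"
proof -
  have "(\<lambda>h. xs ! (h - 1)) ` {1..t} = (\<lambda>h. xs ! (h - 1)) ` Suc ` {0..<t}"
    by (simp only: image_Suc_atLeastLessThan atLeastLessThanSuc_atLeastAtMost One_nat_def)
  also have "\<dots> = (!) xs ` {0..<t}" by (simp only: image_image diff_Suc_1)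
  also have "\<dots> = set (take t xs)" using assms by (simp add: nth_image)
  finally show ?thesis .
qed

text \<open>A list is indexed from \<open>0\<close>, a selection from \<open>1\<close>.\<close>

lemma greedy_selection_of_select:
  fixes key :: "nat \<Rightarrow> real"
  assumes "R \<subseteq> {1..m}" and "k \<le> card R" and "1 \<le> k"
  defines "js \<equiv> fst (select (\<lambda>j i. key i < key j) m k R)"
  shows "length js = k" and "greedy_selection key R k (\<lambda>h. js ! (h - 1))"
proof -
  have js: "length js = k" "distinct js" "set js \<subseteq> R" "sorted_wrt (\<lambda>i j. key j \<le> key i) js"
    "\<forall>i\<in>set js. \<forall>j\<in>R - set js. key j \<le> key i"
    using result_select[OF assms(1,2), of key] unfolding js_def by auto
  show "length js = k" by (fact js)
  have image: "(\<lambda>h. js ! (h - 1)) ` {1..k} = set js"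
    using image_nth_pred_eq_take[of k js] js(1) by simp
  have "inj_on (\<lambda>h. js ! (h - 1)) {1..k}"
    using js(1,2) image by (intro eq_card_imp_inj_on) (auto simp: distinct_card)
  moreover have "key (js ! (Suc h - 1)) \<le> key (js ! (h - 1))" if "h \<in> {1..<k}" for h
    using that js(1,4) by (auto simp: sorted_wrt_iff_nth_less)
  moreover have "js ! (k - 1) \<in> set js" using js(1) \<open>1 \<le> k\<close> by simp
  ultimately show "greedy_selection key R k (\<lambda>h. js ! (h - 1))"
    unfolding greedy_selection_def image using js(3,5) by blast
qed

text \<open>\<open>\<Gamma>\<close> stands for the partial sums; its increments are prescribed only on the part of the lists
  still to be read, so that the claim is inductive. No best pair is stored exactly when nothing has been
  read.\<close>

lemma result_best_prefix:
  fixes \<Gamma> :: "nat \<Rightarrow> real"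
  assumes "length bs = length as" and "0 < t + length as"
    and "\<And>h. h < length as \<Longrightarrow> \<Gamma> (Suc (t + h)) = \<Gamma> (t + h) + (d (bs ! h) - d (as ! h))"
    and "case best of None \<Rightarrow> t = 0
      | Some (tb, gb) \<Rightarrow> gb = \<Gamma> tb \<and> is_arg_max \<Gamma> (\<lambda>s. s \<in> {1..t}) tb"
  shows "is_arg_max \<Gamma> (\<lambda>s. s \<in> {1..t + length as}) (fst (best_prefix d as bs t (\<Gamma> t) best))"
  using assms
proof (induction as arbitrary: bs t best)
  case Nil
  then show ?case by (auto simp: counted_simps split: option.splits)
next
  case (Cons a as)
  then obtain b bs' where bs: "bs = b # bs'" by (cases bs) auto
  define best' where "best' = (if (case best of None \<Rightarrow> True | Some (_, gb) \<Rightarrow> gb < \<Gamma> (Suc t))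
    then Some (Suc t, \<Gamma> (Suc t)) else best)"
  have next_sum: "\<Gamma> (Suc t) = \<Gamma> t + (d b - d a)" using Cons.prems(3)[of 0] bs by simp
  have "fst (best_prefix d (a # as) bs t (\<Gamma> t) best)
      = fst (best_prefix d as bs' (Suc t) (\<Gamma> (Suc t)) best')"
    by (simp add: counted_simps bs best'_def next_sum split: option.split)
  moreover have "case best' of None \<Rightarrow> Suc t = 0
      | Some (tb, gb) \<Rightarrow> gb = \<Gamma> tb \<and> is_arg_max \<Gamma> (\<lambda>s. s \<in> {1..Suc t}) tb"
    using Cons.prems(4)
    by (fastforce simp: best'_def is_arg_max_linorder le_Suc_eq split: option.splits if_splits)
  then have "is_arg_max \<Gamma> (\<lambda>s. s \<in> {1..Suc t + length as})
      (fst (best_prefix d as bs' (Suc t) (\<Gamma> (Suc t)) best'))"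
    using Cons.prems(1) bs Cons.prems(3)[of "Suc _"] by (intro Cons.IH) auto
  ultimately show ?case by simp
qed

text \<open>The program interleaves insertions and deletions. Disjointness of the two lists
  lets all insertions be moved before all deletions.\<close>

lemma result_swap_prefix:
  assumes "t \<le> length as" and "t \<le> length bs" and "set as \<inter> set bs = {}"
  shows "fst (swap_prefix t as bs S) = (S \<union> set (take t bs)) - set (take t as)"
  using assms
proof (induction t as bs S rule: swap_prefix.induct)
  case (1 t a as b bs S)
  have "fst (swap_prefix t as bs (insert b S - {a}))
      = (insert b S - {a} \<union> set (take t bs)) - set (take t as)"
    using 1 by (auto simp: counted_simps)
  moreover have "b \<notin> set (take t as)" "a \<notin> set (take t bs)" "a \<noteq> b"
    using "1.prems" by (auto dest: in_set_takeD)
  ultimately show ?case by (auto simp: counted_simps)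
qed (auto simp: counted_simps)

lemma algorithm_returns_result:
  assumes "valid_input m C S \<Delta>"
  shows "algorithm_returns m d S \<Delta> (result (algorithm m d S \<Delta>))"
proof -
  define K where "K = \<Delta> div 2"
  define as where "as = fst (select (\<lambda>j i. d j < d i) m K S)"
  define bs where "bs = fst (select (\<lambda>j i. d i < d j) m K ({1..m} - S))"
  define t where "t = fst (best_prefix d as bs 0 0 None)"
  define \<sigma>1 where "\<sigma>1 = (\<lambda>h. as ! (h - 1))"
  define \<sigma>2 where "\<sigma>2 = (\<lambda>h. bs ! (h - 1))"
  have S: "S \<subseteq> {1..m}" "K \<le> card S" "K \<le> card ({1..m} - S)" "1 \<le> K"
    using assms card_Diff_subset[of S "{1..m}"] finite_subset[of S "{1..m}"]
    by (auto simp: valid_input_def K_def elim!: evenE)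
  have as: "length as = K" "greedy_selection (\<lambda>j. - d j) S K \<sigma>1"
    using greedy_selection_of_select[of S m K "\<lambda>j. - d j"] S by (auto simp: as_def \<sigma>1_def)
  have bs: "length bs = K" "greedy_selection d ({1..m} - S) K \<sigma>2"
    using greedy_selection_of_select[of "{1..m} - S" m K d] S by (auto simp: bs_def \<sigma>2_def)
  have step1: "step1 m d S K \<sigma>1 \<sigma>2"
    using as bs by (simp add: step1_iff_greedy_selections)
  have "is_arg_max (gamma d \<sigma>1 \<sigma>2) (\<lambda>s. s \<in> {1..0 + length as})
      (fst (best_prefix d as bs 0 (gamma d \<sigma>1 \<sigma>2 0) None))"
    using as bs S(4) by (intro result_best_prefix) (auto simp: gamma_def \<sigma>1_def \<sigma>2_def)
  then have t: "is_arg_max (gamma d \<sigma>1 \<sigma>2) (\<lambda>s. s \<in> {1..K}) t"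
    using as(1) by (simp add: t_def gamma_def)
  then have "t \<le> K" by (simp add: is_arg_max_def)
  have images: "\<sigma>1 ` {1..s} = set (take s as)" "\<sigma>2 ` {1..s} = set (take s bs)" if "s \<le> K" for s
    using that as(1) bs(1) image_nth_pred_eq_take[of s as] image_nth_pred_eq_take[of s bs]
    by (simp_all add: \<sigma>1_def \<sigma>2_def)
  have "set as \<subseteq> S" "set bs \<subseteq> {1..m} - S"
    using step1 images[of K] as(1) bs(1) by (auto simp: step1_def)
  then have "fst (swap_prefix t as bs S) = (S \<union> \<sigma>2 ` {1..t}) - \<sigma>1 ` {1..t}"
    using \<open>t \<le> K\<close> images as(1) bs(1) by (subst result_swap_prefix) auto
  moreover have "result (algorithm m d S \<Delta>) = fst (swap_prefix t as bs S)"
  proof -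
    have "set [1..<Suc m] \<inter> S = S" "set [1..<Suc m] - S = {1..m} - S"
      using S(1) by auto
    then show ?thesis
      by (simp add: algorithm_def result_def counted_simps result_split_sets
          t_def as_def bs_def K_def del: set_upt upt_Suc)
  qed
  ultimately show ?thesis
    unfolding algorithm_returns_def K_def[symmetric] using step1 t by auto
qed

section \<open>Cost\<close>

lemma cost_split_sets: "snd (split_sets S js) = 2 * length js"
  by (induction js) (auto simp: counted_simps)

lemma cost_find_best: "snd (find_best beats R js best) = 2 * length js"
  by (induction js arbitrary: best) (auto simp: counted_simps)

lemma length_select_le: "length (fst (select beats m k R)) \<le> k"
  by (induction k arbitrary: R) (auto simp: counted_simps split: option.splits)

lemma cost_select: "snd (select beats m k R) \<le> k * (2 * m + 1)"
proof (induction k arbitrary: R)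
  case (Suc k)
  then show ?case
    by (auto simp: counted_simps cost_find_best simp del: upt_Suc split: option.splits)
qed (simp add: counted_simps)

lemma cost_best_prefix: "snd (best_prefix d as bs t g best) \<le> 2 * length as"
proof (induction as arbitrary: bs t g best)
  case (Cons a as)
  then show ?case by (cases bs) (simp_all add: counted_simps split del: if_split)
qed (simp add: counted_simps)

lemma cost_swap_prefix: "snd (swap_prefix t as bs S) \<le> 2 * length as"
  by (induction t as bs S rule: swap_prefix.induct) (auto simp: counted_simps)

text \<open>The constant \<open>12\<close> collects the cost \<open>2 m\<close> of splitting, at most \<open>K (2 m + 1)\<close> for each of the two selections and
  at most \<open>2 K\<close> for each of the two final passes; with \<open>1 \<le> m\<close> and \<open>1 \<le> K\<close> this is at most
  \<open>(2 + 6 + 4) m K\<close>.\<close>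

lemma cost_algorithm_le:
  assumes "valid_input m C S \<Delta>"
  shows "cost (algorithm m d S \<Delta>) \<le> 12 * (m * (\<Delta> div 2))"
proof -
  define K where "K = \<Delta> div 2"
  have "1 \<le> m" "1 \<le> K" using assms by (auto simp: valid_input_def K_def elim!: evenE)
  define as where "as = fst (select (\<lambda>j i. d j < d i) m K (fst (fst (split_sets S [1..<Suc m]))))"
  define bs where "bs = fst (select (\<lambda>j i. d j > d i) m K (snd (fst (split_sets S [1..<Suc m]))))"
  have "length as \<le> K" by (simp add: as_def length_select_le)
  have "cost (algorithm m d S \<Delta>)
      = snd (split_sets S [1..<Suc m])
      + (snd (select (\<lambda>j i. d j < d i) m K (fst (fst (split_sets S [1..<Suc m]))))
      + (snd (select (\<lambda>j i. d j > d i) m K (snd (fst (split_sets S [1..<Suc m]))))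
      + (snd (best_prefix d as bs 0 0 None)
      + snd (swap_prefix (fst (best_prefix d as bs 0 0 None)) as bs S))))"
    by (simp add: algorithm_def cost_def counted_simps as_def bs_def K_def del: upt_Suc)
  also have "\<dots> \<le> 2 * m + (K * (2 * m + 1) + (K * (2 * m + 1) + (2 * K + 2 * K)))"
    using \<open>length as \<le> K\<close>
    by (intro add_mono cost_select order.trans[OF cost_best_prefix] order.trans[OF cost_swap_prefix])
      (simp_all add: cost_split_sets del: upt_Suc)
  also have "\<dots> \<le> 12 * (m * K)"
  proof -
    have "m \<le> m * K" "K \<le> m * K" using mult_le_mono[OF \<open>1 \<le> m\<close> order_refl, of K] mult_le_mono[OF order_refl \<open>1 \<le> K\<close>, of m] by simp_all
    moreover have "2 * m + (K * (2 * m + 1) + (K * (2 * m + 1) + (2 * K + 2 * K)))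
        = 2 * m + 4 * (m * K) + 6 * K" by (simp add: algebra_simps)
    ultimately show ?thesis by linarith
  qed
  finally show ?thesis by (simp add: K_def)
qed

section \<open>Optimality and complexity\<close>

theorem proposition3:
  fixes m C \<Delta> :: nat and I :: "'i set" and q :: "'i \<Rightarrow> real" and v :: "'i \<Rightarrow> nat \<Rightarrow> real"
    and G :: "'i \<Rightarrow> (nat \<Rightarrow> real) \<Rightarrow> real"
    and Sbar :: "nat set" and xbar d :: "nat \<Rightarrow> real"
  assumes "finite I" and "\<forall>i\<in>I. 0 \<le> q i" and "\<forall>i\<in>I. cpgf m (G i)"
    and "valid_input m C Sbar \<Delta>" and "xbar = indicator Sbar"
    and "has_gradient m (f_GEV I q v G) xbar d"
  shows
    "(\<forall>S. algorithm_returns m d Sbar \<Delta> S \<longrightarrow>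
        (is_arg_max (objective m d) (\<lambda>x. x \<in> feasible m C xbar \<Delta>) (indicator S) \<or>
         {x. is_arg_max (objective m d) (\<lambda>x. x \<in> feasible m C xbar \<Delta>) x} = {xbar}) \<and>
        is_arg_max (objective m d) (\<lambda>x. x \<in> feasible m C xbar \<Delta> - {xbar}) (indicator S)) \<and>
     algorithm_returns m d Sbar \<Delta> (result (algorithm m d Sbar \<Delta>)) \<and>
     (\<lambda>(m, C, d, S, \<Delta>). real (cost (algorithm m d S \<Delta>)))
       \<in> O[principal {(m, C, d, S, \<Delta>). valid_input m C S \<Delta>}](\<lambda>(m, C, d, S, \<Delta>). real m * (real \<Delta> / 2))"
proof (intro conjI allI impI)
  note greedy = greedy_exchange_optimal[OF assms(4), of d, folded assms(5)]
  show "is_arg_max (objective m d) (\<lambda>x. x \<in> feasible m C xbar \<Delta>) (indicator S) \<or>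
      {x. is_arg_max (objective m d) (\<lambda>x. x \<in> feasible m C xbar \<Delta>) x} = {xbar}"
    if "algorithm_returns m d Sbar \<Delta> S" for S
    using greedy(2)[OF that] .
  show "is_arg_max (objective m d) (\<lambda>x. x \<in> feasible m C xbar \<Delta> - {xbar}) (indicator S)"
    if "algorithm_returns m d Sbar \<Delta> S" for S
    using greedy(1)[OF that] .
  show "algorithm_returns m d Sbar \<Delta> (result (algorithm m d Sbar \<Delta>))"
    using assms(4) by (rule algorithm_returns_result)
  have "real (cost (algorithm m d S \<Delta>)) \<le> 12 * (real m * (real \<Delta> / 2))"
    if valid: "valid_input m C S \<Delta>" for m C d S \<Delta>
  proof -
    have "real \<Delta> / 2 = real (\<Delta> div 2)"
      using valid by (auto simp: valid_input_def elim!: evenE)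
    moreover have "real (cost (algorithm m d S \<Delta>)) \<le> real (12 * (m * (\<Delta> div 2)))"
      using cost_algorithm_le[OF valid] by (rule of_nat_mono)
    ultimately show ?thesis by simp
  qed
  then show "(\<lambda>(m, C, d, S, \<Delta>). real (cost (algorithm m d S \<Delta>)))
      \<in> O[principal {(m, C, d, S, \<Delta>). valid_input m C S \<Delta>}](\<lambda>(m, C, d, S, \<Delta>). real m * (real \<Delta> / 2))"
    by (intro bigoI[where c = 12]) (auto simp: eventually_principal)
qed

end
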